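(* Assume the Gram matrix $\mathcal{G}=(\langle\eta_i,\eta_j\rangle_W)_{i,j=1}^{N_m}$ of the Riesz representers $\eta_1,\dots,\eta_{N_m}$ of the operator $\mathbf{K}:W\to\mathbb{R}^{N_m}$ is positive definite, with spectral factorization $\mathcal{G}=U\Lambda U^T$, $\Lambda=\mathrm{diag}(\lambda_1,\dots,\lambda_{N_m})$, $\lambda_1\ge\dots\ge\lambda_{N_m}>0$, $U=[\mathbf{u}_1,\dots,\mathbf{u}_{N_m}]$ orthogonal, and let $u_{j\ell}$ be the $j$th component of $\mathbf{u}_\ell$. Let $\mathbf{g}\in\mathbb{R}^{N_m}$ and, for $\ell=1,\dots,N_m$, set $$\widehat{c}_\ell=\frac{\mathbf{u}_\ell^T\mathbf{g}}{\sqrt{\lambda_\ell}},\qquad \widehat{\eta}_\ell=\sum_{j=1}^{N_m}\frac{u_{j\ell}}{\sqrt{\lambda_\ell}}\,\eta_j.$$ For $1\le\kappa\le N_m$ define the regularized solution $f^{(\kappa)}=\sum_{\ell=1}^{\kappa}\widehat{c}_\ell\,\widehat{\eta}_\ell$. Then $$f^{(\kappa)}=\sum_{j=1}^{N_m}c_j^{(\kappa)}\eta_j,$$ where $\mathbf{c}^{(\kappa)}=[c^{(\kappa)}_1,\dots,c^{(\kappa)}_{N_m}]^T$ is the truncated eigendecomposition solution with parameter $\kappa$ of the linear system $\mathcal{G}\mathbf{c}=\mathbf{g}$, i.e. $$\mathbf{c}^{(\kappa)}=U\Lambda_\kappa^\dagger U^T\mathbf{g}=\sum_{\ell=1}^{\kappa}\frac{\mathbf{u}_\ell^T\mathbf{g}}{\lambda_\ell}\,\mathbf{u}_\ell,$$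 with $\Lambda_\kappa^\dagger$ the Moore–Penrose pseudoinverse of $\Lambda_\kappa=\mathrm{diag}(\lambda_1,\dots,\lambda_\kappa,0,\dots,0)\in\mathbb{R}^{N_m\times N_m}$.
   Context: Let $a<b$ be real. $W$ is the real Hilbert space $W=\{f\in L^2([a,b]) : f(a)=f(b)=0,\ f,f'\in AC([a,b]),\ f''\in L^2([a,b])\}$, where $AC([a,b])$ denotes the absolutely continuous functions on $[a,b]$, with inner product $\langle f,g\rangle_W=\int_a^b f''(x)g''(x)\,dx$. Let $m\ge1$, $n_1,\dots,n_m\ge 1$, $N_0=0$ and $N_r=\sum_{k=1}^r n_k$. For $r=1,\dots,m$ let $k_r:[c_r,d_r]\times[a,b]\to\mathbb{R}$ be a kernel, let $x_{r,1},\dots,x_{r,n_r}\in[c_r,d_r]$ be given points, and put $(K_r f)(x)=\int_a^b k_r(x,t)f(t)\,dt$. The operator $\mathbf{K}:W\to\mathbb{R}^{N_m}$ is defined by $(\mathbf{K}f)_j=(K_r f)(x_{r,i})$ for $j=i+N_{r-1}$, $r=1,\dots,m$, $i=1,\dots,n_r$. It is a standing assumption that $\mathbf{K}$ is a well-defined bounded linear operator on $W$. Riesz representers: $\eta_1,\dots,\eta_{N_m}\in W$ are the unique functions with $(\mathbf{K}f)_j=\langle\eta_j,f\rangle_W$ for all $f\in W$, $j=1,\dots,N_m$. *)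

theory Defs
  imports "HOL-Analysis.Analysis" "Jordan_Normal_Form.Matrix"
begin

unbundle no vec_syntax
unbundle no inner_syntax

text \<open>
  Vectors and matrices whose dimension is a natural number are those of
  \<^theory>\<open>Jordan_Normal_Form.Matrix\<close>. All indices start at \<open>0\<close>; in particular the entry
  \<open>j = i + N\<^sub>r\<^sub>-\<^sub>1\<close> with \<open>1 \<le> r \<le> m\<close>, \<open>1 \<le> i \<le> n\<^sub>r\<close> becomes
  \<open>j = i + block_start n r\<close> with \<open>r < m\<close>, \<open>i < n r\<close>.
  Functions on \<open>[a, b]\<close> are total functions \<open>real \<Rightarrow> real\<close> whose values outside \<open>[a, b]\<close>
  play no role.
\<close>

definition abs_cont_on :: "real \<Rightarrow> real \<Rightarrow> (real \<Rightarrow> real) \<Rightarrow> bool" where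
  "abs_cont_on a b f \<longleftrightarrow>
     (\<forall>\<epsilon>>0. \<exists>\<delta>>0. \<forall>(p::nat) s t.
        (\<forall>i<p. a \<le> s i \<and> s i \<le> t i \<and> t i \<le> b) \<and>
        disjoint_family_on (\<lambda>i. {s i<..<t i}) {..<p} \<and>
        (\<Sum>i<p. t i - s i) < \<delta>
        \<longrightarrow> (\<Sum>i<p. \<bar>f (t i) - f (s i)\<bar>) < \<epsilon>)"

definition L2_on :: "real \<Rightarrow> real \<Rightarrow> (real \<Rightarrow> real) set" where
  "L2_on a b = {f \<in> borel_measurable (lebesgue_on {a..b}).
                  integrable (lebesgue_on {a..b}) (\<lambda>x. (f x)\<^sup>2)}"

text \<open>
  The derivative is taken within \<open>[a, b]\<close>, hence is one-sided at the end points. For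
  \<open>f \<in> W_space a b\<close> the second derivative exists almost everywhere only; on the exceptional
  null set \<^const>\<open>vector_derivative\<close> is an irrelevant constant.
\<close>

definition deriv_on :: "real \<Rightarrow> real \<Rightarrow> (real \<Rightarrow> real) \<Rightarrow> real \<Rightarrow> real" where
  "deriv_on a b f x = vector_derivative f (at x within {a..b})"

definition deriv2_on :: "real \<Rightarrow> real \<Rightarrow> (real \<Rightarrow> real) \<Rightarrow> real \<Rightarrow> real" where
  "deriv2_on a b f = deriv_on a b (deriv_on a b f)"

definition W_space :: "real \<Rightarrow> real \<Rightarrow> (real \<Rightarrow> real) set" where
  "W_space a b = {f \<in> L2_on a b.
      f a = 0 \<and> f b = 0 \<and>
      abs_cont_on a b f \<and>
      f differentiable_on {a..b} \<and> abs_cont_on a b (deriv_on a b f) \<and>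
      deriv2_on a b f \<in> L2_on a b}"

definition W_inner :: "real \<Rightarrow> real \<Rightarrow> (real \<Rightarrow> real) \<Rightarrow> (real \<Rightarrow> real) \<Rightarrow> real" where
  "W_inner a b f g = (\<integral>x. deriv2_on a b f x * deriv2_on a b g x \<partial>lebesgue_on {a..b})"

definition W_norm :: "real \<Rightarrow> real \<Rightarrow> (real \<Rightarrow> real) \<Rightarrow> real" where
  "W_norm a b f = sqrt (W_inner a b f f)"

definition block_start :: "(nat \<Rightarrow> nat) \<Rightarrow> nat \<Rightarrow> nat" where
  "block_start n r = (\<Sum>k<r. n k)"

definition block_of :: "(nat \<Rightarrow> nat) \<Rightarrow> nat \<Rightarrow> nat" where
  "block_of n j = (LEAST r. j < block_start n (Suc r))"

definition int_op :: "real \<Rightarrow> real \<Rightarrow> (real \<Rightarrow> real \<Rightarrow> real) \<Rightarrow> (real \<Rightarrow> real) \<Rightarrow> real \<Rightarrow> real" where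
  "int_op a b k f x = (\<integral>t. k x t * f t \<partial>lebesgue_on {a..b})"

definition sampled_op ::
  "real \<Rightarrow> real \<Rightarrow> nat \<Rightarrow> (nat \<Rightarrow> nat) \<Rightarrow> (nat \<Rightarrow> real \<Rightarrow> real \<Rightarrow> real) \<Rightarrow> (nat \<Rightarrow> nat \<Rightarrow> real)
     \<Rightarrow> (real \<Rightarrow> real) \<Rightarrow> real Matrix.vec" where
  "sampled_op a b m n k x f =
     Matrix.vec (block_start n m)
       (\<lambda>j. let r = block_of n j; i = j - block_start n r in int_op a b (k r) f (x r i))"

lemma block_start_mono: "r \<le> s \<Longrightarrow> block_start n r \<le> block_start n s"
  unfolding block_start_def by (intro sum_mono2) auto

lemma sampled_op_index:
  assumes "r < m" "i < n r"
  shows "i + block_start n r < block_start n m"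
    and "sampled_op a b m n k x f $ (i + block_start n r) = int_op a b (k r) f (x r i)"
proof -
  have lt: "i + block_start n r < block_start n (Suc r)"
    using assms by (simp add: block_start_def)
  also have "\<dots> \<le> block_start n m"
    using assms by (intro block_start_mono) simp
  finally show dim: "i + block_start n r < block_start n m" .
  have "block_of n (i + block_start n r) = r"
    unfolding block_of_def
  proof (rule Least_equality[where P = "\<lambda>s. i + block_start n r < block_start n (Suc s)", OF lt])
    fix s assume s: "i + block_start n r < block_start n (Suc s)"
    show "r \<le> s"
    proof (rule ccontr)
      assume "\<not> r \<le> s"
      then have "block_start n (Suc s) \<le> block_start n r"
        by (intro block_start_mono) simp
      with s show False by simp
    qed
  qed
  with dim show "sampled_op a b m n k x f $ (i + block_start n r) = int_op a b (k r) f (x r i)"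
    by (simp add: sampled_op_def Let_def)
qed

definition sampled_op_well_defined ::
  "real \<Rightarrow> real \<Rightarrow> nat \<Rightarrow> (nat \<Rightarrow> nat) \<Rightarrow> (nat \<Rightarrow> real \<Rightarrow> real \<Rightarrow> real) \<Rightarrow> (nat \<Rightarrow> nat \<Rightarrow> real)
     \<Rightarrow> bool" where
  "sampled_op_well_defined a b m n k x \<longleftrightarrow>
     (\<forall>r<m. \<forall>i<n r. \<forall>f\<in>W_space a b.
        integrable (lebesgue_on {a..b}) (\<lambda>t. k r (x r i) t * f t))"

definition bounded_linear_on_W ::
  "real \<Rightarrow> real \<Rightarrow> nat \<Rightarrow> ((real \<Rightarrow> real) \<Rightarrow> real Matrix.vec) \<Rightarrow> bool" where
  "bounded_linear_on_W a b N T \<longleftrightarrow>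
     (\<forall>f\<in>W_space a b. T f \<in> carrier_vec N) \<and>
     (\<forall>f\<in>W_space a b. \<forall>g\<in>W_space a b. T (\<lambda>t. f t + g t) = T f + T g) \<and>
     (\<forall>\<alpha>. \<forall>f\<in>W_space a b. T (\<lambda>t. \<alpha> * f t) = \<alpha> \<cdot>\<^sub>v T f) \<and>
     (\<exists>C. \<forall>f\<in>W_space a b. sqrt (T f \<bullet> T f) \<le> C * W_norm a b f)"

definition riesz_representers ::
  "real \<Rightarrow> real \<Rightarrow> nat \<Rightarrow> ((real \<Rightarrow> real) \<Rightarrow> real Matrix.vec) \<Rightarrow> (nat \<Rightarrow> real \<Rightarrow> real) \<Rightarrow> bool" where
  "riesz_representers a b N T \<eta> \<longleftrightarrow>
     (\<forall>j<N. \<eta> j \<in> W_space a b \<and> (\<forall>f\<in>W_space a b. T f $ j = W_inner a b (\<eta> j) f))"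

definition gram_mat :: "real \<Rightarrow> real \<Rightarrow> nat \<Rightarrow> (nat \<Rightarrow> real \<Rightarrow> real) \<Rightarrow> real Matrix.mat" where
  "gram_mat a b N \<eta> = Matrix.mat N N (\<lambda>(i, j). W_inner a b (\<eta> i) (\<eta> j))"

definition pos_def_mat :: "nat \<Rightarrow> real Matrix.mat \<Rightarrow> bool" where
  "pos_def_mat N A \<longleftrightarrow>
     A \<in> carrier_mat N N \<and> A\<^sup>T = A \<and>
     (\<forall>v\<in>carrier_vec N. v \<noteq> 0\<^sub>v N \<longrightarrow> v \<bullet> (A *\<^sub>v v) > 0)"

text \<open>
  The library's \<^const>\<open>orthogonal_mat\<close> only asks for nonzero, pairwise orthogonal columns.
\<close>

definition orthonormal_mat :: "nat \<Rightarrow> real Matrix.mat \<Rightarrow> bool" where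
  "orthonormal_mat N U \<longleftrightarrow> U \<in> carrier_mat N N \<and> U\<^sup>T * U = 1\<^sub>m N \<and> U * U\<^sup>T = 1\<^sub>m N"

definition spectral_factorization ::
  "nat \<Rightarrow> real Matrix.mat \<Rightarrow> real Matrix.mat \<Rightarrow> (nat \<Rightarrow> real) \<Rightarrow> bool" where
  "spectral_factorization N A U \<mu> \<longleftrightarrow>
     orthonormal_mat N U \<and> A = U * mat_diag N \<mu> * U\<^sup>T \<and>
     (\<forall>i j. i \<le> j \<longrightarrow> j < N \<longrightarrow> \<mu> j \<le> \<mu> i)"

text \<open>The four Penrose equations; over the reals the adjoint is the transpose.\<close>

definition is_pseudoinverse :: "real Matrix.mat \<Rightarrow> real Matrix.mat \<Rightarrow> bool" where
  "is_pseudoinverse A X \<longleftrightarrow>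
     X \<in> carrier_mat (dim_col A) (dim_row A) \<and>
     A * X * A = A \<and> X * A * X = X \<and> (A * X)\<^sup>T = A * X \<and> (X * A)\<^sup>T = X * A"

definition pseudoinverse :: "real Matrix.mat \<Rightarrow> real Matrix.mat" where
  "pseudoinverse A = (THE X. is_pseudoinverse A X)"

definition truncated_diag :: "nat \<Rightarrow> nat \<Rightarrow> (nat \<Rightarrow> real) \<Rightarrow> real Matrix.mat" where
  "truncated_diag N \<kappa> \<mu> = mat_diag N (\<lambda>l. if l < \<kappa> then \<mu> l else 0)"

definition ted_solution ::
  "nat \<Rightarrow> real Matrix.mat \<Rightarrow> (nat \<Rightarrow> real) \<Rightarrow> real Matrix.vec \<Rightarrow> nat \<Rightarrow> real Matrix.vec" where
  "ted_solution N U \<mu> g \<kappa> = (U * pseudoinverse (truncated_diag N \<kappa> \<mu>) * U\<^sup>T) *\<^sub>v g"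

definition c_hat ::
  "real Matrix.mat \<Rightarrow> (nat \<Rightarrow> real) \<Rightarrow> real Matrix.vec \<Rightarrow> nat \<Rightarrow> real" where
  "c_hat U \<mu> g l = (col U l \<bullet> g) / sqrt (\<mu> l)"

definition eta_hat ::
  "nat \<Rightarrow> real Matrix.mat \<Rightarrow> (nat \<Rightarrow> real) \<Rightarrow> (nat \<Rightarrow> real \<Rightarrow> real) \<Rightarrow> nat \<Rightarrow> real \<Rightarrow> real" where
  "eta_hat N U \<mu> \<eta> l t = (\<Sum>j<N. U $$ (j, l) / sqrt (\<mu> l) * \<eta> j t)"

definition reg_solution ::
  "nat \<Rightarrow> real Matrix.mat \<Rightarrow> (nat \<Rightarrow> real) \<Rightarrow> real Matrix.vec \<Rightarrow> (nat \<Rightarrow> real \<Rightarrow> real) \<Rightarrow> nat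
     \<Rightarrow> real \<Rightarrow> real" where
  "reg_solution N U \<mu> g \<eta> \<kappa> t = (\<Sum>l<\<kappa>. c_hat U \<mu> g l * eta_hat N U \<mu> \<eta> l t)"

end

theory Submission
  imports Defs
begin

text \<open>Both \<open>c_hat\<close> and \<open>eta_hat\<close> carry a factor
  \<open>1 / sqrt (\<mu> l)\<close>; since \<open>\<mu> l > 0\<close>, the two multiply to
  \<open>1 / \<mu> l\<close>. Exchanging the finite sums over \<open>l\<close> and \<open>j\<close>
  then shows that the coefficient of \<open>\<eta> j\<close> in the regularized solution is the
  \<open>j\<close>-th component of the truncated eigenvector expansion
  (\<open>reg_solution_eq_ted_solution\<close>). What remains is to identify this expansion with the
  matrix formula defining \<open>ted_solution\<close>: the pseudoinverse of a diagonal matrix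
  inverts the nonzero entries and keeps the zeros (\<open>pseudoinverse_mat_diag\<close>), so
  conjugating by \<open>U\<close> leaves exactly the terms with \<open>l < \<kappa>\<close>
  (\<open>ted_solution_index\<close>, \<open>ted_solution_eq_finsum_vec\<close>).\<close>

text \<open>By the Penrose equations, \<open>A * X\<close> and \<open>A * Y\<close> are both the
  orthogonal projector onto the range of \<open>A\<close>, hence equal; dually
  \<open>X * A = Y * A\<close>. Uniqueness is what makes the definite description in
  \<open>pseudoinverse\<close> computable from a candidate.\<close>

lemma is_pseudoinverse_unique:
  assumes X: "is_pseudoinverse A X" and Y: "is_pseudoinverse A Y"
  shows "X = Y"
proof -
  define m n where "m = dim_row A" and "n = dim_col A"
  have A [simp]: "A \<in> carrier_mat m n"
    by (auto simp: m_def n_def)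
  have XY [simp]: "X \<in> carrier_mat n m" "Y \<in> carrier_mat n m"
    using X Y by (auto simp: is_pseudoinverse_def m_def n_def)
  have left: "A * X = A * Y"
  proof -
    have "A * X = (A * Y * A) * X"
      using Y by (simp add: is_pseudoinverse_def)
    also have "\<dots> = (A * Y) * (A * X)"
      by (rule assoc_mult_mat[OF mult_carrier_mat[OF A XY(2)] A XY(1)])
    \<comment> \<open>Symmetry of both projectors reverses the order of the product, after which
      \<open>A * X * A = A\<close> absorbs \<open>X\<close> instead of \<open>Y\<close>.\<close>
    also have "\<dots> = (A * Y)\<^sup>T * (A * X)\<^sup>T"
      using X Y by (simp add: is_pseudoinverse_def)
    also have "\<dots> = ((A * X) * (A * Y))\<^sup>T"
      by (rule transpose_mult[symmetric, OF mult_carrier_mat[OF A XY(1)] mult_carrier_mat[OF A XY(2)]])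
    also have "(A * X) * (A * Y) = (A * X * A) * Y"
      by (rule assoc_mult_mat[symmetric, OF mult_carrier_mat[OF A XY(1)] A XY(2)])
    also have "(\<dots>)\<^sup>T = A * Y"
      using X Y by (simp add: is_pseudoinverse_def)
    finally show ?thesis .
  qed
  have right: "X * A = Y * A"
  proof -
    have "X * A = X * (A * Y * A)"
      using Y by (simp add: is_pseudoinverse_def)
    also have "\<dots> = (X * A) * (Y * A)"
      by (simp add: assoc_mult_mat[OF A XY(2) A]
          assoc_mult_mat[OF XY(1) A mult_carrier_mat[OF XY(2) A]])
    also have "\<dots> = (X * A)\<^sup>T * (Y * A)\<^sup>T"
      using X Y by (simp add: is_pseudoinverse_def)
    also have "\<dots> = ((Y * A) * (X * A))\<^sup>T"
      by (rule transpose_mult[symmetric, OF mult_carrier_mat[OF XY(2) A] mult_carrier_mat[OF XY(1) A]])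
    also have "(Y * A) * (X * A) = Y * (A * X * A)"
      by (simp add: assoc_mult_mat[OF A XY(1) A]
          assoc_mult_mat[OF XY(2) A mult_carrier_mat[OF XY(1) A]])
    also have "(\<dots>)\<^sup>T = Y * A"
      using X Y by (simp add: is_pseudoinverse_def)
    finally show ?thesis .
  qed
  \<comment> \<open>The two projector identities replace \<open>X\<close> by \<open>Y\<close> one
    factor at a time.\<close>
  have "X = X * A * X"
    using X by (simp add: is_pseudoinverse_def)
  also have "\<dots> = Y * (A * X)"
    unfolding right by (rule assoc_mult_mat[OF XY(2) A XY(1)])
  also have "\<dots> = Y * A * Y"
    unfolding left by (rule assoc_mult_mat[symmetric, OF XY(2) A XY(2)])
  also have "\<dots> = Y"
    using Y by (simp add: is_pseudoinverse_def)
  finally show ?thesis .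
qed

text \<open>Zero entries need no case distinction because \<open>inverse 0 = 0\<close>.\<close>

lemma pseudoinverse_mat_diag:
  "pseudoinverse (mat_diag n f) = mat_diag n (\<lambda>i. inverse (f i))"
proof -
  have eq: "f i * inverse (f i) * f i = f i" "inverse (f i) * f i * inverse (f i) = inverse (f i)" for i
    by (cases "f i = 0"; simp)+
  have tr: "(mat_diag n h)\<^sup>T = mat_diag n h" for h :: "nat \<Rightarrow> real"
    by (rule eq_matI) (auto simp: mat_diag_def)
  have "is_pseudoinverse (mat_diag n f) (mat_diag n (\<lambda>i. inverse (f i)))"
    by (simp add: is_pseudoinverse_def tr eq carrier_matD[OF mat_diag_dim])
  then show ?thesis
    unfolding pseudoinverse_def by (blast intro: the_equality is_pseudoinverse_unique)
qed

text \<open>\<open>U\<^sup>T\<close> takes the inner products of \<open>g\<close> with the columns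
  of \<open>U\<close>, the diagonal scales them by \<open>h\<close>, and \<open>U\<close> recombines
  the columns.\<close>

lemma mat_diag_conj_mult_vec_index:
  fixes U :: "'a::comm_semiring_1 Matrix.mat"
  assumes U: "U \<in> carrier_mat n n" and g: "g \<in> carrier_vec n" and j: "j < n"
  shows "((U * mat_diag n h * U\<^sup>T) *\<^sub>v g) $ j = (\<Sum>l<n. h l * (col U l \<bullet> g) * U $$ (j, l))"
proof -
  have UT: "U\<^sup>T \<in> carrier_mat n n"
    using U by simp
  have "(U * mat_diag n h * U\<^sup>T) *\<^sub>v g = (U * mat_diag n h) *\<^sub>v (U\<^sup>T *\<^sub>v g)"
    by (rule assoc_mult_mat_vec[OF mult_carrier_mat[OF U mat_diag_dim] UT g])
  then show ?thesis
    using U j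
    by (simp add: mat_diag_mult_right[OF U] scalar_prod_def lessThan_atLeast0 mult_ac)
qed

lemma ted_solution_index:
  assumes U: "U \<in> carrier_mat N N" and g: "g \<in> carrier_vec N" and "\<kappa> \<le> N" and j: "j < N"
  shows "ted_solution N U \<mu> g \<kappa> $ j = (\<Sum>l<\<kappa>. (col U l \<bullet> g) / \<mu> l * U $$ (j, l))"
proof -
  have "ted_solution N U \<mu> g \<kappa> $ j =
      (\<Sum>l<N. inverse (if l < \<kappa> then \<mu> l else 0) * (col U l \<bullet> g) * U $$ (j, l))"
    unfolding ted_solution_def truncated_diag_def pseudoinverse_mat_diag
    by (rule mat_diag_conj_mult_vec_index[OF U g j])
  \<comment> \<open>Terms with \<open>l \<ge> \<kappa>\<close> drop out because
    \<open>inverse 0 = 0\<close>; \<open>\<kappa> \<le> N\<close> keeps the shorter range inside the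
    longer one.\<close>
  also have "\<dots> = (\<Sum>l<\<kappa>. inverse (if l < \<kappa> then \<mu> l else 0) * (col U l \<bullet> g) * U $$ (j, l))"
    using \<open>\<kappa> \<le> N\<close> by (intro sum.mono_neutral_right) auto
  also have "\<dots> = (\<Sum>l<\<kappa>. (col U l \<bullet> g) / \<mu> l * U $$ (j, l))"
    by (simp add: field_simps)
  finally show ?thesis .
qed

text \<open>The vector form of \<open>ted_solution_index\<close>, obtained by comparing
  components.\<close>

lemma ted_solution_eq_finsum_vec:
  assumes U: "U \<in> carrier_mat N N" and g: "g \<in> carrier_vec N" and "\<kappa> \<le> N"
  shows "ted_solution N U \<mu> g \<kappa>
    = finsum_vec TYPE(real) N (\<lambda>l. ((col U l \<bullet> g) / \<mu> l) \<cdot>\<^sub>v col U l) {..<\<kappa>}"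
    (is "_ = finsum_vec _ _ ?v _")
proof -
  have v: "?v \<in> {..<\<kappa>} \<rightarrow> carrier_vec N"
    using U by auto
  have dim: "dim_vec (finsum_vec TYPE(real) N ?v {..<\<kappa>}) = N"
    using finsum_vec_closed[OF v] by simp
  show ?thesis
  proof (rule eq_vecI)
    fix j assume "j < dim_vec (finsum_vec TYPE(real) N ?v {..<\<kappa>})"
    then have j: "j < N"
      by (simp add: dim)
    have "finsum_vec TYPE(real) N ?v {..<\<kappa>} $ j = (\<Sum>l<\<kappa>. ?v l $ j)"
      by (rule index_finsum_vec[OF _ j v]) simp
    also have "\<dots> = ted_solution N U \<mu> g \<kappa> $ j"
      unfolding ted_solution_index[OF assms j]
      using U j \<open>\<kappa> \<le> N\<close> by (intro sum.cong) auto
    finally show "ted_solution N U \<mu> g \<kappa> $ j = finsum_vec TYPE(real) N ?v {..<\<kappa>} $ j" ..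
  next
    show "dim_vec (ted_solution N U \<mu> g \<kappa>) = dim_vec (finsum_vec TYPE(real) N ?v {..<\<kappa>})"
      using U by (simp add: dim ted_solution_def)
  qed
qed

lemma reg_solution_eq_ted_solution:
  assumes U: "U \<in> carrier_mat N N" and g: "g \<in> carrier_vec N" and "\<kappa> \<le> N"
    and pos: "\<And>l. l < N \<Longrightarrow> \<mu> l > 0"
  shows "reg_solution N U \<mu> g \<eta> \<kappa> t = (\<Sum>j<N. ted_solution N U \<mu> g \<kappa> $ j * \<eta> j t)"
proof -
  \<comment> \<open>Here positivity enters: it gives
    \<open>sqrt (\<mu> l) * sqrt (\<mu> l) = \<mu> l\<close>, merging the two
    normalizations.\<close>
  have *: "p / sqrt (\<mu> l) * (q / sqrt (\<mu> l) * y) = p / \<mu> l * q * y" if "l < \<kappa>" for l p q y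
    using pos[of l] that \<open>\<kappa> \<le> N\<close> by (simp add: field_simps)
  have "reg_solution N U \<mu> g \<eta> \<kappa> t =
      (\<Sum>l<\<kappa>. \<Sum>j<N. (col U l \<bullet> g) / \<mu> l * U $$ (j, l) * \<eta> j t)"
    unfolding reg_solution_def c_hat_def eta_hat_def sum_distrib_left
    by (intro sum.cong refl *) simp
  also have "\<dots> = (\<Sum>j<N. \<Sum>l<\<kappa>. (col U l \<bullet> g) / \<mu> l * U $$ (j, l) * \<eta> j t)"
    by (rule sum.swap)
  also have "\<dots> = (\<Sum>j<N. ted_solution N U \<mu> g \<kappa> $ j * \<eta> j t)"
    using assms by (intro sum.cong refl) (simp add: ted_solution_index sum_distrib_right)
  finally show ?thesis .
qed

theorem mainTheorem3:
  fixes a b :: real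
    and m :: nat and n :: "nat \<Rightarrow> nat"
    and c d :: "nat \<Rightarrow> real"
    and k :: "nat \<Rightarrow> real \<Rightarrow> real \<Rightarrow> real"
    and x :: "nat \<Rightarrow> nat \<Rightarrow> real"
    and \<eta> :: "nat \<Rightarrow> real \<Rightarrow> real"
    and U :: "real Matrix.mat" and \<mu> :: "nat \<Rightarrow> real"
    and g :: "real Matrix.vec"
    and N \<kappa> :: nat
  assumes "a < b"
    and "m \<ge> 1" and "\<And>r. r < m \<Longrightarrow> n r \<ge> 1"
    and "N = block_start n m"
    and "\<And>r i. r < m \<Longrightarrow> i < n r \<Longrightarrow> x r i \<in> {c r..d r}"
    and "sampled_op_well_defined a b m n k x"
    and "bounded_linear_on_W a b N (sampled_op a b m n k x)"
    and "riesz_representers a b N (sampled_op a b m n k x) \<eta>"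
    and "pos_def_mat N (gram_mat a b N \<eta>)"
    and "spectral_factorization N (gram_mat a b N \<eta>) U \<mu>"
    and "\<And>l. l < N \<Longrightarrow> \<mu> l > 0"
    and "g \<in> carrier_vec N"
    and "1 \<le> \<kappa>" and "\<kappa> \<le> N"
  shows "ted_solution N U \<mu> g \<kappa>
           = finsum_vec TYPE(real) N (\<lambda>l. ((col U l \<bullet> g) / \<mu> l) \<cdot>\<^sub>v col U l) {..<\<kappa>}
       \<and> (\<forall>t\<in>{a..b}. reg_solution N U \<mu> g \<eta> \<kappa> t = (\<Sum>j<N. ted_solution N U \<mu> g \<kappa> $ j * \<eta> j t))"
proof -
  have U: "U \<in> carrier_mat N N"
    using assms(10) by (simp add: spectral_factorization_def orthonormal_mat_def)
  have "reg_solution N U \<mu> g \<eta> \<kappa> t = (\<Sum>j<N. ted_solution N U \<mu> g \<kappa> $ j * \<eta> j t)" for t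
    by (rule reg_solution_eq_ted_solution) (use U assms in auto)
  with ted_solution_eq_finsum_vec[OF U assms(12,14)] show ?thesis
    by blast
qed

end
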